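(* Let $\mathcal{X}$ be a finite set, let $\pi$ be a probability measure on $\mathcal{X}$ with strictly positive masses, and let $P\in\mathcal{L}(\pi)$. Let $\mathcal{X}=S\sqcup S'$ with $S,S'$ non-empty, $\mathcal{O}_1=S$, $\mathcal{O}_2=S'$, and $\pi(S)\le\pi(S')$, and let $G$ and $\overline{P}$ be the Gibbs kernel and projection chain of this two-block partition, with $\overline{\pi}=(\pi(S),\pi(S'))$. Then $$\alpha\left(\overline{P}^2\right)=\frac{\overline{P}^2(1,2)\,(1-2\pi(S))}{\pi(S')\log(\pi(S')/\pi(S))},$$ and hence, for every $l\in\mathbb{N}$, $$D_{\mathrm{KL}}^\pi\left((GPG)^l\,\|\,\Pi\right)\le\left(1-\frac{\overline{P}^2(1,2)\,(1-2\pi(S))}{\pi(S')\log(\pi(S')/\pi(S))}\right)^l\log2,$$ where, when $\pi(S)=\pi(S')=\tfrac12$, the factor $\frac{1-2\pi(S)}{\log(\pi(S')/\pi(S))}$ is interpreted as its limiting value $\tfrac12$.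
   Context: $\mathbb{N}=\{1,2,\dots\}$. $\mathcal{L}(\pi)$ is the set of $\pi$-reversible transition matrices on $\mathcal{X}$. The Gibbs kernel is $G(x,y)=\pi(y)/\pi(\mathcal{O}(x))$ if $y\in\mathcal{O}(x)$ and $0$ otherwise, where $\mathcal{O}(x)$ is the block containing $x$ and $\pi(A)=\sum_{z\in A}\pi(z)$. $\Pi$ is the matrix all of whose rows equal $\pi$. The projection chain is the $2\times2$ transition matrix $\overline{P}(i,j)=\frac{1}{\pi(\mathcal{O}_i)}\sum_{x\in\mathcal{O}_i,\,y\in\mathcal{O}_j}\pi(x)P(x,y)$, and $\overline{P}^2=\overline{P}\,\overline{P}$. $D^\pi_{\mathrm{KL}}(A\|B)=\sum_{x,y}\pi(x)A(x,y)\log\frac{A(x,y)}{B(x,y)}$, with $0\log(0/a)=0$. The log-Sobolev constant of a $\mu$-stationary transition matrix $Q$ is $\alpha(Q)=\inf\{\langle(I-Q)f,f\rangle_\mu/\mathscr{L}(f): f\text{ real-valued},\ \mathscr{L}(f)\neq0\}$, where $\mathscr{L}(f)=\sum_x|f(x)|^2\log(|f(x)|^2/\|f\|_\mu^2)\mu(x)$, $\langle f,g\rangle_\mu=\sum_xf(x)g(x)\mu(x)$ and $\|f\|_\mu^2=\langle f,f\rangle_\mu$ (for $\alpha(\overline{P}^2)$, take $\mu=\overline{\pi}$). *)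

theory Defs
  imports "HOL-Analysis.Analysis" "HOL-Real_Asymp.Real_Asymp"
begin

text \<open>
  Measures on a finite set are vectors \<open>real^'a\<close> and kernels are matrices \<open>real^'a^'a\<close>,
  the finite set being the index type; \<open>A $ x $ y\<close> is the entry \<open>A(x, y)\<close>.
\<close>

definition prob_vector :: "real^'a::finite \<Rightarrow> bool" where
  "prob_vector p \<longleftrightarrow> (\<forall>x. 0 \<le> p $ x) \<and> (\<Sum>x\<in>UNIV. p $ x) = 1"

definition transition_matrix :: "real^'a::finite^'a \<Rightarrow> bool" where
  "transition_matrix P \<longleftrightarrow> (\<forall>x. prob_vector (P $ x))"

definition reversible_kernels :: "real^'a::finite \<Rightarrow> (real^'a^'a) set" where
  "reversible_kernels p =
     {P. transition_matrix P \<and> (\<forall>x y. p $ x * P $ x $ y = p $ y * P $ y $ x)}"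

definition mass :: "real^'a::finite \<Rightarrow> 'a set \<Rightarrow> real" where
  "mass p A = (\<Sum>z\<in>A. p $ z)"

text \<open>The operation \<open>^\<close> on \<open>real^'a^'a\<close> is the entrywise power, not the matrix power.\<close>

primrec matpow :: "real^'a::finite^'a \<Rightarrow> nat \<Rightarrow> real^'a^'a" where
  "matpow A 0 = mat 1"
| "matpow A (Suc n) = A ** matpow A n"

definition const_rows :: "real^'a::finite \<Rightarrow> real^'a^'a" where
  "const_rows p = (\<chi> x. p)"

text \<open>
  A partition is given by its indexed family of blocks \<open>Ob :: 'k \<Rightarrow> 'a set\<close>. The definite
  description in \<open>block_of\<close> is meaningful when the blocks are disjoint and cover the space.
\<close>

definition block_of :: "('k \<Rightarrow> 'a set) \<Rightarrow> 'a \<Rightarrow> 'a set" where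
  "block_of Ob x = Ob (THE i. x \<in> Ob i)"

definition gibbs_kernel :: "real^'a::finite \<Rightarrow> ('k \<Rightarrow> 'a set) \<Rightarrow> real^'a^'a" where
  "gibbs_kernel p Ob =
     (\<chi> x y. if y \<in> block_of Ob x then p $ y / mass p (block_of Ob x) else 0)"

definition proj_measure :: "real^'a::finite \<Rightarrow> ('k \<Rightarrow> 'a set) \<Rightarrow> real^'k" where
  "proj_measure p Ob = (\<chi> i. mass p (Ob i))"

definition proj_chain ::
  "real^'a::finite \<Rightarrow> ('k \<Rightarrow> 'a set) \<Rightarrow> real^'a^'a \<Rightarrow> real^'k^'k" where
  "proj_chain p Ob P =
     (\<chi> i j. 1 / mass p (Ob i) * (\<Sum>x\<in>Ob i. \<Sum>y\<in>Ob j. p $ x * P $ x $ y))"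

text \<open>
  Terms with \<open>A(x, y) = 0\<close> vanish, as in the convention \<open>0 log (0 / a) = 0\<close>. The divergence
  is real-valued, so it is the usual one only if \<open>B(x, y) = 0\<close> implies \<open>A(x, y) = 0\<close> wherever
  \<open>p(x) > 0\<close>; it is not \<open>\<infinity>\<close> otherwise. A matrix \<open>B\<close> with positive entries is always fine.
\<close>

definition KL_div :: "real^'a::finite \<Rightarrow> real^'a^'a \<Rightarrow> real^'a^'a \<Rightarrow> real" where
  "KL_div p A B =
     (\<Sum>x\<in>UNIV. \<Sum>y\<in>UNIV. p $ x * A $ x $ y * ln (A $ x $ y / B $ x $ y))"

definition inner_wrt :: "real^'n::finite \<Rightarrow> real^'n \<Rightarrow> real^'n \<Rightarrow> real" where
  "inner_wrt \<mu> f g = (\<Sum>x\<in>UNIV. f $ x * g $ x * \<mu> $ x)"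

text \<open>Since \<open>ln 0 = 0\<close> here, terms with \<open>f(x) = 0\<close> vanish, as in \<open>0 log 0 = 0\<close>.\<close>

definition entropy_form :: "real^'n::finite \<Rightarrow> real^'n \<Rightarrow> real" where
  "entropy_form \<mu> f =
     (\<Sum>x\<in>UNIV. \<bar>f $ x\<bar>\<^sup>2 * ln (\<bar>f $ x\<bar>\<^sup>2 / inner_wrt \<mu> f f) * \<mu> $ x)"

text \<open>
  If \<open>\<mu>\<close> is a positive probability vector on at least two points and \<open>Q\<close> is a \<open>\<mu>\<close>-stationary
  transition matrix, the set below is non-empty and consists of non-negative reals, so the real
  infimum is the genuine one.
\<close>

definition log_sobolev :: "real^'n::finite \<Rightarrow> real^'n^'n \<Rightarrow> real" where
  "log_sobolev \<mu> Q =
     Inf {inner_wrt \<mu> ((mat 1 - Q) *v f) f / entropy_form \<mu> f | f. entropy_form \<mu> f \<noteq> 0}"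

definition two_blocks :: "'a set \<Rightarrow> 'a set \<Rightarrow> 2 \<Rightarrow> 'a set" where
  "two_blocks S S' = (\<lambda>i. if i = 1 then S else S')"

text \<open>
  For \<open>t = 1 - s\<close> this is \<open>(1 - 2 s) / log (t / s)\<close>, continued to \<open>s = t = 1/2\<close> by the limit
  computed in the lemma that follows.
\<close>

definition two_point_factor :: "real \<Rightarrow> real \<Rightarrow> real" where
  "two_point_factor s t = (if s = t then 1 / 2 else (1 - 2 * s) / ln (t / s))"

lemma two_point_factor_limit:
  "((\<lambda>s::real. (1 - 2 * s) / ln ((1 - s) / s)) \<longlongrightarrow> 1 / 2) (at (1 / 2))"
  by real_asymp

end

theory Submission
  imports Defs
begin

text \<open>
  A kernel that depends on the starting point only through its block, and is proportional to \<open>p\<close>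
  within each target block, is the lift of a kernel on the blocks. Lifting is multiplicative and
  preserves the divergence to equilibrium, and \<open>G ** P ** G\<close> is the lift of \<open>Pb\<close>, so the bound
  concerns \<open>matpow Pb l\<close> only. There, \<open>Ent (g\<^sup>2) \<ge> Var g\<close> under each row of \<open>Pb\<close>, integrated
  against the stationary measure, bounds the entropy dissipated by one step below by
  \<open>\<parallel>g\<parallel>\<^sup>2 - \<parallel>Pb g\<parallel>\<^sup>2\<close>, which is the Dirichlet form of \<open>Pb ** Pb\<close>. Hence each step contracts the
  divergence by \<open>1 - \<alpha>\<close>, starting from an entropy of at most \<open>ln 2\<close>.

  On two points of mass \<open>s < t\<close> the log-Sobolev inequality is sharp at the function with values
  \<open>t\<close> and \<open>s\<close>; for \<open>s = t\<close> its constant is only approached, by functions tending to a constant.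
\<close>

section \<open>Contraction of entropy by reversible kernels\<close>

text \<open>Write \<open>c\<close> for the square root of \<open>m\<close>. The bound ln(c/h) <= c/h
  - 1, weighted by \<open>w * h^2\<close> and summed, bounds the entropy below by
  \<open>2 * m - 2 * c * a\<close>, where \<open>a\<close> is the mean of \<open>h\<close>. This
  exceeds \<open>m - a^2\<close> by \<open>(c - a)^2\<close>. The lemma is used twice: for the
  measure \<open>p\<close> itself and for each row of a kernel.\<close>

lemma entropy_ge_variance:
  fixes w h :: "'i \<Rightarrow> real"
  assumes "finite I" and w: "\<And>i. i \<in> I \<Longrightarrow> 0 \<le> w i" and h: "\<And>i. i \<in> I \<Longrightarrow> 0 \<le> h i"
  defines "m \<equiv> \<Sum>i\<in>I. w i * (h i)\<^sup>2"
  shows "m - (\<Sum>i\<in>I. w i * h i)\<^sup>2 \<le> (\<Sum>i\<in>I. w i * ((h i)\<^sup>2 * ln ((h i)\<^sup>2))) - m * ln m"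
proof (cases "m = 0")
  case True
  then have "\<forall>i\<in>I. w i * (h i)\<^sup>2 = 0"
    unfolding m_def using assms(1) w by (subst (asm) sum_nonneg_eq_0_iff) auto
  then have "(\<Sum>i\<in>I. w i * ((h i)\<^sup>2 * ln ((h i)\<^sup>2))) = 0"
    by (intro sum.neutral) auto
  then show ?thesis using True by simp
next
  case False
  moreover have "0 \<le> m" unfolding m_def using w by (intro sum_nonneg) auto
  ultimately have m: "0 < m" by simp
  define c where "c = sqrt m"
  have c: "0 < c" "c\<^sup>2 = m" using m by (auto simp: c_def)
  define a where "a = (\<Sum>i\<in>I. w i * h i)"
  have "2 * (w i * (h i)\<^sup>2) - 2 * c * (w i * h i) \<le> w i * ((h i)\<^sup>2 * ln ((h i)\<^sup>2)) - w i * (h i)\<^sup>2 * ln m"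
    if "i \<in> I" for i
  proof (cases "h i = 0")
    case False
    then have hi: "0 < h i" using h[OF that] by simp
    have "ln (c / h i) \<le> c / h i - 1"
      using c hi by (intro ln_le_minus_one) simp
    moreover have "ln ((h i)\<^sup>2) - ln m = - 2 * ln (c / h i)"
      using c(1) hi unfolding c(2)[symmetric] by (simp add: ln_realpow ln_div)
    ultimately have "2 - 2 * (c / h i) \<le> ln ((h i)\<^sup>2) - ln m" by linarith
    then have "(w i * (h i)\<^sup>2) * (2 - 2 * (c / h i)) \<le> (w i * (h i)\<^sup>2) * (ln ((h i)\<^sup>2) - ln m)"
      using w[OF that] by (intro mult_left_mono) auto
    moreover have "(w i * (h i)\<^sup>2) * (2 - 2 * (c / h i)) = 2 * (w i * (h i)\<^sup>2) - 2 * c * (w i * h i)"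
      using hi by (simp add: field_simps power2_eq_square)
    ultimately show ?thesis by (simp add: algebra_simps)
  qed simp
  then have "(\<Sum>i\<in>I. 2 * (w i * (h i)\<^sup>2) - 2 * c * (w i * h i))
      \<le> (\<Sum>i\<in>I. w i * ((h i)\<^sup>2 * ln ((h i)\<^sup>2)) - w i * (h i)\<^sup>2 * ln m)"
    by (rule sum_mono)
  then have "2 * m - 2 * c * a \<le> (\<Sum>i\<in>I. w i * ((h i)\<^sup>2 * ln ((h i)\<^sup>2))) - m * ln m"
    by (simp add: sum_subtractf m_def a_def sum_distrib_left sum_distrib_right)
  moreover have "m - a\<^sup>2 \<le> 2 * m - 2 * c * a"
    using zero_le_power2[of "c - a"] c by (simp add: power2_eq_square algebra_simps)
  ultimately show ?thesis by (simp add: a_def)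
qed

lemma sum_prob_vector: "prob_vector p \<Longrightarrow> (\<Sum>x\<in>UNIV. p $ x) = 1"
  and prob_vector_nonneg: "prob_vector p \<Longrightarrow> 0 \<le> p $ x"
  by (auto simp: prob_vector_def)

text \<open>Splitting the logarithm of the quotient brings the form into the shape of
  \<open>entropy_ge_variance\<close>. If the norm is zero, every weighted square vanishes, so the
  value of \<open>ln 0\<close> does no harm.\<close>

lemma entropy_form_eq:
  assumes "\<And>x. 0 \<le> p $ x"
  shows "entropy_form p f = (\<Sum>x\<in>UNIV. p $ x * ((f $ x)\<^sup>2 * ln ((f $ x)\<^sup>2)))
           - inner_wrt p f f * ln (inner_wrt p f f)"
proof (cases "inner_wrt p f f = 0")
  case True
  then have "\<forall>x. f $ x * f $ x * p $ x = 0"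
    unfolding inner_wrt_def using assms by (subst (asm) sum_nonneg_eq_0_iff) auto
  then have "(\<Sum>x\<in>UNIV. p $ x * ((f $ x)\<^sup>2 * ln ((f $ x)\<^sup>2))) = 0"
    by (intro sum.neutral) auto
  with True show ?thesis by (simp add: entropy_form_def)
next
  case False
  moreover have "0 \<le> inner_wrt p f f"
    unfolding inner_wrt_def using assms by (intro sum_nonneg) auto
  ultimately have "0 < inner_wrt p f f" by simp
  then have "\<bar>f $ x\<bar>\<^sup>2 * ln (\<bar>f $ x\<bar>\<^sup>2 / inner_wrt p f f) * p $ x
      = p $ x * ((f $ x)\<^sup>2 * ln ((f $ x)\<^sup>2)) - f $ x * f $ x * p $ x * ln (inner_wrt p f f)" for x
    by (cases "f $ x = 0") (simp_all add: ln_div algebra_simps power2_eq_square)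
  then show ?thesis
    by (simp add: entropy_form_def sum_subtractf sum_distrib_right[symmetric]) 
      (simp add: inner_wrt_def)
qed

lemma sum_square_le_sum_mult_square:
  fixes w h :: "'i::finite \<Rightarrow> real"
  assumes "\<And>i. 0 \<le> w i" and "sum w UNIV = 1"
  shows "(\<Sum>i\<in>UNIV. w i * h i)\<^sup>2 \<le> (\<Sum>i\<in>UNIV. w i * (h i)\<^sup>2)"
  using convex_on_sum[OF finite UNIV_not_empty convex_power2 assms(2), of h] assms(1)
  by simp

text \<open>The entropy form sees only the squares of \<open>f\<close>, so
  \<open>entropy_ge_variance\<close>, which requires non-negative values, can be applied to the
  absolute values.\<close>

lemma variance_le_entropy_form:
  assumes p: "prob_vector p" 
  shows "inner_wrt p f f - (\<Sum>x\<in>UNIV. p $ x * \<bar>f $ x\<bar>)\<^sup>2 \<le> entropy_form p f"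
proof -
  have "(\<Sum>x\<in>UNIV. p $ x * \<bar>f $ x\<bar>\<^sup>2) = inner_wrt p f f"
    by (simp add: inner_wrt_def power2_eq_square mult_ac)
  then show ?thesis
    using entropy_ge_variance[of UNIV "\<lambda>x. p $ x" "\<lambda>x. \<bar>f $ x\<bar>"] prob_vector_nonneg[OF p]
    by (simp add: entropy_form_eq)
qed

lemma entropy_form_nonneg:
  assumes p: "prob_vector p" 
  shows "0 \<le> entropy_form p f"
proof -
  have "(\<Sum>x\<in>UNIV. p $ x * \<bar>f $ x\<bar>\<^sup>2) = inner_wrt p f f"
    by (simp add: inner_wrt_def power2_eq_square mult_ac)
  moreover have "(\<Sum>x\<in>UNIV. p $ x * \<bar>f $ x\<bar>)\<^sup>2 \<le> (\<Sum>x\<in>UNIV. p $ x * \<bar>f $ x\<bar>\<^sup>2)"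
    using p by (intro sum_square_le_sum_mult_square) (auto simp: prob_vector_def)
  ultimately show ?thesis
    using variance_le_entropy_form[OF p, of f] by linarith
qed

section \<open>Self-adjointness, Dirichlet forms and one-step contraction\<close>

lemma reversible_kernel_rows:
  assumes "P \<in> reversible_kernels p"
  shows "0 \<le> P $ x $ y" and "(\<Sum>y\<in>UNIV. P $ x $ y) = 1"
  using assms by (auto simp: reversible_kernels_def transition_matrix_def prob_vector_def)

lemma reversible_kernel_balance:
  "P \<in> reversible_kernels p \<Longrightarrow> p $ x * P $ x $ y = p $ y * P $ y $ x"
  by (auto simp: reversible_kernels_def)

lemma reversible_kernel_stationary:
  assumes "P \<in> reversible_kernels p"
  shows "(\<Sum>x\<in>UNIV. p $ x * (\<Sum>y\<in>UNIV. P $ x $ y * h y)) = (\<Sum>y\<in>UNIV. p $ y * h y)"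
proof -
  have "(\<Sum>x\<in>UNIV. p $ x * (\<Sum>y\<in>UNIV. P $ x $ y * h y)) = (\<Sum>x\<in>UNIV. \<Sum>y\<in>UNIV. p $ y * P $ y $ x * h y)"
    using reversible_kernel_balance[OF assms] by (simp add: sum_distrib_left mult.assoc[symmetric])
  also have "\<dots> = (\<Sum>y\<in>UNIV. p $ y * h y * (\<Sum>x\<in>UNIV. P $ y $ x))"
    by (subst sum.swap) (simp add: sum_distrib_left mult_ac)
  finally show ?thesis using reversible_kernel_rows[OF assms] by simp
qed

lemma inner_wrt_mult_vec_commute:
  assumes "P \<in> reversible_kernels p"
  shows "inner_wrt p (P *v f) g = inner_wrt p f (P *v g)"
proof -
  have "inner_wrt p (P *v f) g = (\<Sum>x\<in>UNIV. \<Sum>y\<in>UNIV. p $ y * P $ y $ x * f $ y * g $ x)"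
    using reversible_kernel_balance[OF assms]
    by (simp add: inner_wrt_def matrix_vector_mult_def sum_distrib_left sum_distrib_right mult_ac)
  also have "\<dots> = inner_wrt p f (P *v g)"
    by (subst sum.swap)
      (simp add: inner_wrt_def matrix_vector_mult_def sum_distrib_left sum_distrib_right mult_ac)
  finally show ?thesis .
qed

text \<open>A reversible kernel is self-adjoint for the inner product weighted by \<open>p\<close>,
  so one factor of \<open>P ** P\<close> can be moved to the other argument.\<close>

lemma dirichlet_form_square:
  assumes "P \<in> reversible_kernels p"
  shows "inner_wrt p ((mat 1 - P ** P) *v f) f = inner_wrt p f f - inner_wrt p (P *v f) (P *v f)"
proof -
  have "inner_wrt p ((mat 1 - P ** P) *v f) f = inner_wrt p f f - inner_wrt p (P *v (P *v f)) f"
    by (simp add: matrix_vector_mult_diff_rdistrib matrix_vector_mul_assoc inner_wrt_def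
        left_diff_distrib sum_subtractf)
  then show ?thesis using inner_wrt_mult_vec_commute[OF assms] by simp
qed

text \<open>Passing from the infimum to an inequality for every \<open>f\<close> requires the
  quotients to be bounded below. They are non-negative because \<open>P\<close> contracts the norm:
  Jensen in each row, then stationarity. The same fact settles functions of zero entropy.\<close>

lemma log_sobolev_inequality:
  assumes p: "prob_vector p" and P: "P \<in> reversible_kernels p"
  shows "log_sobolev p (P ** P) * entropy_form p f
           \<le> inner_wrt p f f - inner_wrt p (P *v f) (P *v f)"
proof -
  have nonneg: "0 \<le> inner_wrt p ((mat 1 - P ** P) *v f) f" for f
  proof -
    have "((P *v f) $ x)\<^sup>2 \<le> (\<Sum>y\<in>UNIV. P $ x $ y * (f $ y)\<^sup>2)" for x
      unfolding matrix_vector_mult_def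
      using sum_square_le_sum_mult_square[of "\<lambda>y. P $ x $ y"] reversible_kernel_rows[OF P] by simp
    then have "(\<Sum>x\<in>UNIV. p $ x * ((P *v f) $ x)\<^sup>2) \<le> (\<Sum>x\<in>UNIV. p $ x * (\<Sum>y\<in>UNIV. P $ x $ y * (f $ y)\<^sup>2))"
      by (intro sum_mono mult_left_mono prob_vector_nonneg[OF p])
    then show ?thesis
      unfolding dirichlet_form_square[OF P] reversible_kernel_stationary[OF P]
      by (simp add: inner_wrt_def power2_eq_square mult_ac)
  qed
  show ?thesis
  proof (cases "entropy_form p f = 0")
    case True
    then show ?thesis using nonneg[of f] by (simp add: dirichlet_form_square[OF P])
  next
    case False
    with entropy_form_nonneg[OF p] have pos: "0 < entropy_form p f"
      by (metis less_eq_real_def)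
    have "log_sobolev p (P ** P) \<le> inner_wrt p ((mat 1 - P ** P) *v f) f / entropy_form p f"
      unfolding log_sobolev_def
    proof (rule cInf_lower)
      show "bdd_below {inner_wrt p ((mat 1 - P ** P) *v f) f / entropy_form p f |f. entropy_form p f \<noteq> 0}"
        using nonneg entropy_form_nonneg[OF p] by (intro bdd_belowI[of _ 0]) auto
    qed (use False in auto)
    then show ?thesis
      using pos by (simp add: dirichlet_form_square[OF P] pos_le_divide_eq)
  qed
qed

lemma entropy_contraction:
  assumes p: "prob_vector p" and P: "P \<in> reversible_kernels p"
    and f: "\<And>x. 0 \<le> f $ x" "(\<Sum>x\<in>UNIV. p $ x * f $ x) = 1"
  shows "(\<Sum>x\<in>UNIV. p $ x * ((P *v f) $ x * ln ((P *v f) $ x)))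
           \<le> (1 - log_sobolev p (P ** P)) * (\<Sum>x\<in>UNIV. p $ x * (f $ x * ln (f $ x)))"
proof -
  \<comment> \<open>With \<open>g\<close> the square root of the density \<open>f\<close>, the form
    \<open>entropy_form p g\<close> is the entropy of \<open>f\<close>, and \<open>g\<close> has
    norm 1.\<close>
  define g where "g = (\<chi> x. sqrt (f $ x))"
  have g: "(g $ x)\<^sup>2 = f $ x" "0 \<le> g $ x" for x
    using f by (simp_all add: g_def)
  have gg: "inner_wrt p g g = 1"
    unfolding f(2)[symmetric] by (simp add: inner_wrt_def flip: g power2_eq_square mult.commute)
  have ent: "entropy_form p g = (\<Sum>x\<in>UNIV. p $ x * (f $ x * ln (f $ x)))"
    using prob_vector_nonneg[OF p] by (simp add: entropy_form_eq g gg)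
  have "(P *v f) $ x - ((P *v g) $ x)\<^sup>2
      \<le> (\<Sum>y\<in>UNIV. P $ x $ y * (f $ y * ln (f $ y))) - (P *v f) $ x * ln ((P *v f) $ x)" for x
    using entropy_ge_variance[of UNIV "\<lambda>y. P $ x $ y" "\<lambda>y. g $ y"] reversible_kernel_rows[OF P] g
    by (simp add: matrix_vector_mult_def)
  then have "(\<Sum>x\<in>UNIV. p $ x * ((P *v f) $ x - ((P *v g) $ x)\<^sup>2))
      \<le> (\<Sum>x\<in>UNIV. p $ x * ((\<Sum>y\<in>UNIV. P $ x $ y * (f $ y * ln (f $ y))) - (P *v f) $ x * ln ((P *v f) $ x)))"
    by (intro sum_mono mult_left_mono prob_vector_nonneg[OF p])
  moreover have "(\<Sum>x\<in>UNIV. p $ x * (P *v f) $ x) = 1"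
    unfolding matrix_vector_mult_def using reversible_kernel_stationary[OF P, of "\<lambda>x. f $ x"] f by simp
  moreover have "inner_wrt p (P *v g) (P *v g) = (\<Sum>x\<in>UNIV. p $ x * ((P *v g) $ x)\<^sup>2)"
    by (simp add: inner_wrt_def power2_eq_square mult_ac)
  ultimately have "1 - inner_wrt p (P *v g) (P *v g)
      \<le> (\<Sum>x\<in>UNIV. p $ x * (f $ x * ln (f $ x))) - (\<Sum>x\<in>UNIV. p $ x * ((P *v f) $ x * ln ((P *v f) $ x)))"
    by (simp add: right_diff_distrib sum_subtractf reversible_kernel_stationary[OF P])
  then show ?thesis
    using log_sobolev_inequality[OF p P, of g] by (simp add: gg ent algebra_simps)
qed

text \<open>Summing over the starting point first makes column \<open>y\<close> contribute the
  entropy of the density \<open>A $ x $ y / p $ y\<close> in \<open>x\<close>. Multiplying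
  \<open>A\<close> by a kernel on the left acts on each column separately, so one-step entropy
  bounds apply column by column.\<close>

lemma KL_div_const_rows_eq:
  assumes "\<And>x. 0 < p $ x"
  shows "KL_div p A (const_rows p)
           = (\<Sum>y\<in>UNIV. p $ y * (\<Sum>x\<in>UNIV. p $ x * (A $ x $ y / p $ y * ln (A $ x $ y / p $ y))))"
proof -
  have "p $ y * (\<Sum>x\<in>UNIV. p $ x * (A $ x $ y / p $ y * ln (A $ x $ y / p $ y)))
      = (\<Sum>x\<in>UNIV. p $ x * A $ x $ y * ln (A $ x $ y / const_rows p $ x $ y))" for y
    using assms[of y] by (simp add: sum_distrib_left const_rows_def mult.assoc)
  then show ?thesis
    unfolding KL_div_def by (subst sum.swap) simp
qed

text \<open>The argument of Miclo: apply the entropy contraction to each column of \<open>A\<close>, rescaled to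
  a density with respect to \<open>p\<close>.\<close>

lemma KL_div_contraction:
  assumes p: "prob_vector p" "\<And>x. 0 < p $ x" and P: "P \<in> reversible_kernels p"
    and A: "\<And>x y. 0 \<le> A $ x $ y" "\<And>y. (\<Sum>x\<in>UNIV. p $ x * A $ x $ y) = p $ y"
  shows "KL_div p (P ** A) (const_rows p)
           \<le> (1 - log_sobolev p (P ** P)) * KL_div p A (const_rows p)"
proof -
  define f where "f y = (\<chi> x. A $ x $ y / p $ y)" for y
  have "0 \<le> f y $ x" for x y
    using A(1) p(2) by (simp add: f_def less_imp_le)
  moreover have "(\<Sum>x\<in>UNIV. p $ x * f y $ x) = 1" for y
    using A(2)[of y] p(2)[of y] by (simp add: f_def flip: sum_divide_distrib)
  moreover have Pf: "(P ** A) $ x $ y / p $ y = (P *v f y) $ x" for x y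
    by (simp add: f_def matrix_matrix_mult_def matrix_vector_mult_def sum_divide_distrib)
  moreover have fA: "A $ x $ y / p $ y = f y $ x" for x y
    by (simp add: f_def)
  ultimately show ?thesis
    unfolding KL_div_const_rows_eq[OF p(2)] Pf fA sum_distrib_left[of "1 - _"]
    using entropy_contraction[OF p(1) P] p(2)
    by (intro sum_mono) (simp add: mult.left_commute[of "1 - _"] less_imp_le mult_left_mono)
qed

section \<open>The log-Sobolev constant on two points\<close>

text \<open>For \<open>x > 1\<close> this says that the logarithmic mean of \<open>x\<close> and 1
  is at most their arithmetic mean. The difference vanishes at 1 and has derivative (u-1)^2 / (u
  (u+1)^2). At \<open>t / s\<close> it yields the condition \<open>2 \<le> L\<close> below.\<close>

lemma ln_ge_two_mult:
  assumes "1 \<le> (x::real)"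
  shows "2 * (x - 1) / (x + 1) \<le> ln x"
proof -
  let ?f = "\<lambda>x::real. ln x - 2 * (x - 1) / (x + 1)"
  have "?f 1 \<le> ?f x"
  proof (rule DERIV_nonneg_imp_nondecreasing[OF assms], intro exI conjI)
    fix u :: real assume u: "1 \<le> u"
    have "((\<lambda>x. 2 * (x - 1) / (x + 1)) has_real_derivative 4 / (u + 1)\<^sup>2) (at u)"
      using u by (auto intro!: derivative_eq_intros simp: power2_eq_square algebra_simps)
    with u show "(?f has_real_derivative 1 / u - 4 / (u + 1)\<^sup>2) (at u)"
      by (intro DERIV_diff DERIV_ln_divide) auto
    have "4 * u \<le> (u + 1)\<^sup>2"
      using zero_le_power2[of "u - 1"] by (simp add: power2_eq_square algebra_simps)
    then show "0 \<le> 1 / u - 4 / (u + 1)\<^sup>2"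
      using u by (simp add: field_simps)
  qed
  then show ?thesis by simp
qed

lemma DERIV_mult_ln_self:
  fixes h :: "real \<Rightarrow> real"
  assumes "(h has_real_derivative D) (at u)" and "0 < h u"
  shows "((\<lambda>x. h x * ln (h x)) has_real_derivative D * (ln (h u) + 1)) (at u)"
  using assms by (auto intro!: derivative_eq_intros simp: field_simps)

text \<open>
  \<open>F x\<close> is the deficit in the log-Sobolev inequality on two points of mass \<open>s\<close> and \<open>t\<close> for the
  function with values \<open>x\<close> and \<open>1\<close>, and \<open>F' x = 2 s x G x\<close>. Both \<open>F\<close> and \<open>G\<close> vanish at \<open>1\<close> and at the
  extremal ratio \<open>t / s\<close>.
\<close>

lemma two_point_deficit_nonneg:
  fixes s t L :: real
  assumes s: "0 < s" "s \<le> t" "s + t = 1" and L: "2 \<le> L" "L * (t - s) = ln t - ln s"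
    and "0 < x"
  defines "F \<equiv> \<lambda>x. s * t * (x - 1)\<^sup>2 * L + (s * x\<^sup>2 + t) * ln (s * x\<^sup>2 + t) - s * (x\<^sup>2 * ln (x\<^sup>2))"
    and "G \<equiv> \<lambda>x. t * L * (1 - 1 / x) + ln (s + t / x\<^sup>2)"
  shows "0 \<le> F x" and "t / s \<le> x \<Longrightarrow> 0 \<le> G x"
proof -
  have t: "0 < t" using s by simp
  let ?k = "\<lambda>x. L * (s * x\<^sup>2 + t) - 2 * x"
  have N: "0 < s * u\<^sup>2 + t" for u
    using s t by (simp add: add_nonneg_pos)
  have N': "0 < s + t / u\<^sup>2" for u
    using s t by (simp add: add_pos_nonneg)
  \<comment> \<open>\<open>?k\<close> carries the sign of the derivative of \<open>G\<close>. Since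
    \<open>s + t = 1\<close> and \<open>L\<close> is at least 2, it is non-negative wherever the
    product on the left is, hence outside the interval between 1 and \<open>t / s\<close>.\<close>
  have k: "2 * ((u - 1) * (s * u - t)) \<le> ?k u" for u
  proof -
    have "(u - 1) * (s * u - t) = s * u\<^sup>2 + t - u * (s + t)"
      by (simp add: algebra_simps power2_eq_square)
    moreover have "2 * (s * u\<^sup>2 + t) \<le> L * (s * u\<^sup>2 + t)"
      using L N[of u] by (intro mult_right_mono) auto
    ultimately show ?thesis using s by simp
  qed
  have dF: "(F has_real_derivative 2 * s * u * G u) (at u)" if "0 < u" for u
  proof -
    have "ln (s + t / u\<^sup>2) = ln (s * u\<^sup>2 + t) - ln (u\<^sup>2)"
    proof -
      have "s + t / u\<^sup>2 = (s * u\<^sup>2 + t) / u\<^sup>2"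
        using that by (simp add: field_simps)
      then show ?thesis using that N[of u] by (simp add: ln_div)
    qed
    then have "2 * s * u * G u = 2 * s * u * (t * L * (1 - 1 / u)) + 2 * s * u * (ln (s * u\<^sup>2 + t) - ln (u\<^sup>2))"
      unfolding G_def distrib_left by simp
    also have "2 * s * u * (t * L * (1 - 1 / u)) = 2 * s * t * L * (u - 1)"
      using that by (simp add: field_simps)
    finally have "2 * s * u * G u = 2 * s * t * L * (u - 1) + 2 * s * u * (ln (s * u\<^sup>2 + t) - ln (u\<^sup>2))" .
    moreover have "(F has_real_derivative 2 * s * t * L * (u - 1) + 2 * s * u * (ln (s * u\<^sup>2 + t) - ln (u\<^sup>2))) (at u)"
    proof -
      have "((\<lambda>x. s * x\<^sup>2 + t) has_real_derivative 2 * s * u) (at u)"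
        by (auto intro!: derivative_eq_intros)
      note d1 = DERIV_mult_ln_self[OF this N]
      have "((\<lambda>x. x\<^sup>2) has_real_derivative 2 * u) (at u)"
        by (auto intro!: derivative_eq_intros)
      then have d2: "((\<lambda>x. x\<^sup>2 * ln (x\<^sup>2)) has_real_derivative 2 * u * (ln (u\<^sup>2) + 1)) (at u)"
        by (rule DERIV_mult_ln_self) (use that in simp)
      have d3: "((\<lambda>x. s * t * (x - 1)\<^sup>2 * L) has_real_derivative 2 * s * t * L * (u - 1)) (at u)"
        by (auto intro!: derivative_eq_intros)
      show ?thesis
        unfolding F_def
        by (rule DERIV_cong[OF DERIV_diff[OF DERIV_add[OF d3 d1] DERIV_cmult[OF d2]]])
          (simp add: algebra_simps)
    qed
    ultimately show ?thesis by simp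
  qed
  have dG: "(G has_real_derivative t / (u\<^sup>2 * (s * u\<^sup>2 + t)) * ?k u) (at u)" if "0 < u" for u
  proof -
    have "(G has_real_derivative t * L / u\<^sup>2 + (- 2 * t / u ^ 3) / (s + t / u\<^sup>2)) (at u)"
    proof -
      have "((\<lambda>x. s + t / x\<^sup>2) has_real_derivative - 2 * t / u ^ 3) (at u)"
        using that by (auto intro!: derivative_eq_intros) (simp add: field_simps eval_nat_numeral)
      note d1 = DERIV_chain2[OF DERIV_ln_divide[OF N'] this]
      have d2: "((\<lambda>x. t * L * (1 - 1 / x)) has_real_derivative t * L / u\<^sup>2) (at u)"
        using that by (auto intro!: derivative_eq_intros) (simp add: field_simps power2_eq_square)
      show ?thesis
        unfolding G_def by (rule DERIV_cong[OF DERIV_add[OF d2 d1]]) simp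
    qed
    moreover have "s + t / u\<^sup>2 = (s * u\<^sup>2 + t) / u\<^sup>2"
      using that by (simp add: field_simps)
    moreover have "t * L / u\<^sup>2 + (- 2 * t / u ^ 3) / (M / u\<^sup>2) = t / (u\<^sup>2 * M) * (L * M - 2 * u)" if "0 < M" for M
      using that \<open>0 < u\<close> by (simp add: field_simps eval_nat_numeral)
    note this[OF N]
    ultimately show ?thesis by (simp only:)
  qed
  have pos: "0 < t / (u\<^sup>2 * (s * u\<^sup>2 + t))" if "0 < u" for u
    using that t N[of u] by simp
  have ts: "1 \<le> t / s" using s by simp
  \<comment> \<open>The two terms of \<open>G\<close> become \<open>L * (t - s)\<close> and ln(s/t),
    which cancel by the choice of \<open>L\<close>.\<close>
  have Gts: "G (t / s) = 0"
  proof -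
    have "s + t / (t / s)\<^sup>2 = s * (s + t) / t"
      using s(1) t by (simp add: field_simps power2_eq_square)
    then have "s + t / (t / s)\<^sup>2 = s / t"
      using s(3) by simp
    moreover have "t * L * (1 - 1 / (t / s)) = L * (t - s)"
      using s(1) t by (simp add: field_simps)
    ultimately show ?thesis
      using s(1) t L(2) by (simp add: G_def ln_div)
  qed
  have G1: "G 1 = 0" using s by (simp add: G_def)
  have F1: "F 1 = 0" using s by (simp add: F_def)
  have Fts: "F (t / s) = 0"
  proof -
    have "s * (t / s)\<^sup>2 + t = t * (s + t) / s"
      using s(1) by (simp add: field_simps power2_eq_square)
    then have 1: "s * (t / s)\<^sup>2 + t = t / s"
      using s(3) by simp
    have "s * t * (t / s - 1)\<^sup>2 * L = (t / s) * (t - s) * (L * (t - s))"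
      using s(1) by (simp add: field_simps power2_eq_square)
    then have 2: "s * t * (t / s - 1)\<^sup>2 * L = (t / s) * (t - s) * ln (t / s)"
      using s(1) t L(2) by (simp add: ln_div)
    have "ln ((t / s)\<^sup>2) = 2 * ln (t / s)"
      using s(1) t ln_realpow[of "t / s" 2] by simp
    moreover have "s * (t / s)\<^sup>2 = (t / s) * t"
      using s(1) by (simp add: power2_eq_square)
    ultimately have 3: "s * ((t / s)\<^sup>2 * ln ((t / s)\<^sup>2)) = (t / s) * (2 * t) * ln (t / s)"
      by (simp add: mult.assoc[symmetric])
    have "a * b * l + a * l - a * c * l = a * (b + 1 - c) * l" for a b c l :: real
      by (simp add: algebra_simps)
    then have "F (t / s) = (t / s) * (t - s + 1 - 2 * t) * ln (t / s)"
      unfolding F_def 1 2 3 .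
    also have "t - s + 1 - 2 * t = 0" using s(3) by linarith
    finally show ?thesis by simp
  qed
  have G_mono: "G a \<le> G b" if "0 < a" "a \<le> b" "\<And>v. a \<le> v \<Longrightarrow> v \<le> b \<Longrightarrow> 0 \<le> (v - 1) * (s * v - t)" for a b
  proof (rule DERIV_nonneg_imp_nondecreasing[OF that(2)])
    fix v assume v: "a \<le> v" "v \<le> b"
    then have "0 \<le> ?k v" using k[of v] that(3)[of v] by linarith
    moreover have "0 < v" using v that(1) by linarith
    ultimately show "\<exists>D. (G has_real_derivative D) (at v) \<and> 0 \<le> D"
      using dG[of v] pos[of v] by (meson mult_nonneg_nonneg less_imp_le)
  qed
  have G_nonneg: "0 \<le> G u" if "t / s \<le> u" for u
  proof -
    have "G (t / s) \<le> G u"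
    proof (rule G_mono)
      fix v assume v: "t / s \<le> v"
      then have "t \<le> s * v" using s(1) by (simp add: field_simps)
      then show "0 \<le> (v - 1) * (s * v - t)"
        using v ts by (intro mult_nonneg_nonneg) linarith+
    qed (use that s(1) t in simp_all)
    then show ?thesis using Gts by simp
  qed
  \<comment> \<open>This half of the claim serves the case where the second value of the function is
    0: there the ratio is infinite and the bound comes from the limit of \<open>G\<close>.\<close>
  then show "0 \<le> G x" if "t / s \<le> x" using that .
  have G_nonpos: "G u \<le> 0" if "0 < u" "u \<le> 1" for u
  proof -
    have "G u \<le> G 1"
    proof (rule G_mono)
      fix v :: real assume v: "v \<le> 1"
      have "s * v \<le> s * 1" using v s(1) by (intro mult_left_mono) auto
      then show "0 \<le> (v - 1) * (s * v - t)"
        using v s(2) by (intro mult_nonpos_nonpos) auto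
    qed (use that in simp_all)
    then show ?thesis using G1 by simp
  qed
  \<comment> \<open>To the left of 1 and to the right of \<open>t / s\<close> the sign of
    \<open>G\<close> makes \<open>F\<close> monotone towards a zero. The range between the zeros is
    settled by counting sign changes.\<close>
  consider "x \<le> 1" | "t / s \<le> x" | "1 < x" "x < t / s" by linarith
  then show "0 \<le> F x"
  proof cases
    case 1
    have "F 1 \<le> F x"
    proof (rule DERIV_nonpos_imp_nonincreasing[OF 1])
      fix v assume v: "x \<le> v" "v \<le> 1"
      then have "2 * s * v * G v \<le> 0"
        using G_nonpos[of v] \<open>0 < x\<close> s(1) by (intro mult_nonneg_nonpos) auto
      then show "\<exists>D. (F has_real_derivative D) (at v) \<and> D \<le> 0"
        using dF[of v] v \<open>0 < x\<close> by force
    qed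
    then show ?thesis using F1 by simp
  next
    case 2
    have "F (t / s) \<le> F x"
    proof (rule DERIV_nonneg_imp_nondecreasing[OF 2])
      fix v assume v: "t / s \<le> v"
      then have "0 < v" using ts by linarith
      moreover have "0 \<le> 2 * s * v * G v"
        using G_nonneg[OF v] \<open>0 < v\<close> s(1) by simp
      ultimately show "\<exists>D. (F has_real_derivative D) (at v) \<and> 0 \<le> D"
        using dF[of v] by blast
    qed
    then show ?thesis using Fts by simp
  next
    case 3
    show ?thesis
    proof (rule ccontr)
      text \<open>If \<open>F\<close> dips below zero between its zeros, then \<open>G\<close> has sign pattern \<open>0, -, +, 0\<close>, and
        the convex quadratic \<open>?k\<close> would have sign pattern \<open>-, +, -\<close>.\<close>
      assume neg: "\<not> 0 \<le> F x"
      obtain u where u: "1 < u" "u < x" "F x - F 1 = (x - 1) * (2 * s * u * G u)"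
        using MVT2[of 1 x F "\<lambda>u. 2 * s * u * G u"] 3 dF by force
      have Gu: "G u < 0"
        using neg F1 u s by (smt (verit, best) mult_nonneg_nonneg mult_pos_pos)
      obtain v where v: "x < v" "v < t / s" "F (t / s) - F x = (t / s - x) * (2 * s * v * G v)"
        using MVT2[of x "t / s" F "\<lambda>u. 2 * s * u * G u"] 3 dF by force
      have "0 < (t / s - x) * (2 * s * v * G v)"
        using v(3) Fts neg by linarith
      then have "0 < 2 * s * v * G v"
        by (rule zero_less_mult_pos) (use v(2) 3 in linarith)
      then have Gv: "0 < G v"
        by (rule zero_less_mult_pos) (use v(1) 3 s(1) in simp)
      let ?G' = "\<lambda>u. t / (u\<^sup>2 * (s * u\<^sup>2 + t)) * ?k u"
      \<comment> \<open>The other factor of the derivative of \<open>G\<close> is positive, so an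
        increment of \<open>G\<close> reveals the sign of \<open>?k\<close> at some intermediate
        point.\<close>
      have mvt: "\<exists>w. a < w \<and> w < b \<and> sgn (?k w) = sgn (G b - G a)" if "1 \<le> a" "a < b" for a b
      proof -
        have "\<exists>w>a. w < b \<and> G b - G a = (b - a) * ?G' w"
          by (rule MVT2[OF that(2)]) (rule dG, use that(1) in linarith)
        then obtain w where w: "a < w" "w < b" "G b - G a = (b - a) * ?G' w"
          by blast
        have "sgn (G b - G a) = sgn (b - a) * (sgn (t / (w\<^sup>2 * (s * w\<^sup>2 + t))) * sgn (?k w))"
          by (simp only: w(3) sgn_mult)
        also have "\<dots> = sgn (?k w)"
        proof -
          have "sgn (b - a) = 1" "sgn (t / (w\<^sup>2 * (s * w\<^sup>2 + t))) = 1"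
            using that w(1) by (intro sgn_pos pos; linarith)+
          then show ?thesis by (simp only: mult_1)
        qed
        finally show ?thesis using w(1,2) by metis
      qed
      obtain w1 where w1: "w1 < u" "?k w1 < 0"
        using mvt[of 1 u] u(1) Gu G1 by (metis diff_0_right order_refl sgn_less)
      obtain w2 where w2: "u < w2" "w2 < v" "0 < ?k w2"
        using mvt[of u v] u(1,2) v(1) Gu Gv by (smt (verit) sgn_greater)
      obtain w3 where w3: "v < w3" "?k w3 < 0"
        using mvt[of v "t / s"] 3(1) v(1,2) Gv Gts by (smt (verit) sgn_less)
      \<comment> \<open>This is the second divided difference of a quadratic with leading
        coefficient \<open>L * s\<close>, cleared of denominators. It is positive, while the signs
        found at \<open>w1\<close>, \<open>w2\<close>, \<open>w3\<close> make the left side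
        negative.\<close>
      have "?k w1 * (w3 - w2) + ?k w3 * (w2 - w1) - ?k w2 * (w3 - w1)
          = L * s * ((w2 - w1) * (w3 - w2) * (w3 - w1))"
        by (simp add: algebra_simps power2_eq_square)
      also have "\<dots> > 0"
        using w1 w2 w3 L s by simp
      moreover have "?k w1 * (w3 - w2) < 0" "?k w3 * (w2 - w1) < 0" "?k w2 * (w3 - w1) > 0"
        using w1 w2 w3 by (simp_all add: mult_neg_pos)
      ultimately show False by linarith
    qed
  qed
qed

text \<open>Both sides are homogeneous of degree 2, so for positive values the claim is
  \<open>b^2\<close> times the deficit inequality at the ratio \<open>a / b\<close>. A zero value
  has to be treated apart.\<close>

lemma two_point_entropy_le:
  fixes s t L a b :: real
  assumes s: "0 < s" "s \<le> t" "s + t = 1" and L: "2 \<le> L" "L * (t - s) = ln t - ln s"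
    and a: "0 \<le> a" "0 \<le> b"
  shows "s * (a\<^sup>2 * ln (a\<^sup>2)) + t * (b\<^sup>2 * ln (b\<^sup>2)) - (s * a\<^sup>2 + t * b\<^sup>2) * ln (s * a\<^sup>2 + t * b\<^sup>2)
           \<le> s * t * L * (a - b)\<^sup>2"
proof -
  have t: "0 < t" "1 / 2 \<le> t" using s by simp_all
  consider "a = 0" | "b = 0" | "0 < a" "0 < b" using a by linarith
  then show ?thesis
  proof cases
    case 1
    \<comment> \<open>Here the claim reduces to \<open>- ln t \<le> s * L\<close>, which follows
      from \<open>1 \<le> t * L\<close>, as \<open>t\<close> is at least 1/2 and \<open>L\<close> at
      least 2.\<close>
    have "ln (1 / t) \<le> 1 / t - 1" using t by (intro ln_le_minus_one) simp
    also have "1 / t - 1 = (1 - t) / t"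
      using t(1) by (simp add: diff_divide_distrib)
    also have "1 - t = s" using s(3) by simp
    also have "s / t \<le> s * L"
    proof -
      have "1 \<le> t * L" using mult_mono[of "1 / 2" t 2 L] t L by simp
      then have "s * 1 \<le> s * (t * L)" using s(1) by (intro mult_left_mono) auto
      then show ?thesis using t(1) by (simp add: field_simps)
    qed
    finally have "- ln t \<le> s * L" using t(1) by (simp add: ln_div)
    then have "(t * b\<^sup>2) * (- ln t) \<le> (t * b\<^sup>2) * (s * L)"
      using t(1) by (intro mult_left_mono) auto
    moreover have "t * (b\<^sup>2 * ln (b\<^sup>2)) - t * b\<^sup>2 * ln (t * b\<^sup>2) = (t * b\<^sup>2) * (- ln t)"
      using t(1) by (cases "b = 0") (simp_all add: ln_mult algebra_simps)
    ultimately show ?thesis using 1 by (simp add: mult_ac)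
  next
    case 2
    \<comment> \<open>Here the claim reduces to \<open>- ln s \<le> t * L\<close>, the limit at
      infinity of the inequality \<open>0 \<le> G x\<close>.\<close>
    have "((\<lambda>x. t * L * (1 - 1 / x) + ln (s + t / x\<^sup>2)) \<longlongrightarrow> t * L * (1 - 0) + ln (s + 0)) at_top"
      using s(1) by (intro tendsto_intros real_tendsto_divide_at_top[OF tendsto_const]
          filterlim_pow_at_top filterlim_ident) auto
    moreover have "\<forall>\<^sub>F x in at_top. 0 \<le> t * L * (1 - 1 / x) + ln (s + t / x\<^sup>2)"
      using eventually_ge_at_top[of "t / s"]
    proof eventually_elim
      case (elim x)
      moreover have "0 < t / s" using s(1) t by simp
      ultimately have "0 < x" by linarith
      then show ?case using two_point_deficit_nonneg(2)[OF s L] elim by simp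
    qed
    ultimately have "0 \<le> t * L * (1 - 0) + ln (s + 0)"
      by (rule tendsto_lowerbound) simp
    then have "(s * a\<^sup>2) * (- ln s) \<le> (s * a\<^sup>2) * (t * L)"
      using s(1) by (intro mult_left_mono) auto
    moreover have "s * (a\<^sup>2 * ln (a\<^sup>2)) - s * a\<^sup>2 * ln (s * a\<^sup>2) = (s * a\<^sup>2) * (- ln s)"
      using s(1) by (cases "a = 0") (simp_all add: ln_mult algebra_simps)
    ultimately show ?thesis using 2 by (simp add: mult_ac)
  next
    case 3
    define x where "x = a / b"
    have x: "0 < x" "a = x * b" using 3 by (simp_all add: x_def)
    define M where "M = s * x\<^sup>2 + t"
    have M: "0 < M" using s(1) t x by (simp add: M_def add_nonneg_pos)
    have 1: "s * a\<^sup>2 + t * b\<^sup>2 = M * b\<^sup>2" "a\<^sup>2 = x\<^sup>2 * b\<^sup>2" "(a - b)\<^sup>2 = (x - 1)\<^sup>2 * b\<^sup>2"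
      unfolding M_def x(2) by (simp_all add: algebra_simps power2_eq_square)
    have 2: "ln (M * b\<^sup>2) = ln M + ln (b\<^sup>2)" "ln (x\<^sup>2 * b\<^sup>2) = ln (x\<^sup>2) + ln (b\<^sup>2)"
      using M x 3 by (simp_all add: ln_mult)
    have "0 \<le> b\<^sup>2 * (s * t * (x - 1)\<^sup>2 * L + M * ln M - s * (x\<^sup>2 * ln (x\<^sup>2)))"
      using two_point_deficit_nonneg(1)[OF s L x(1)] by (intro mult_nonneg_nonneg) (simp_all add: M_def)
    also have "\<dots> = s * t * L * ((x - 1)\<^sup>2 * b\<^sup>2) - (s * (x\<^sup>2 * b\<^sup>2 * (ln (x\<^sup>2) + ln (b\<^sup>2)))
        + t * (b\<^sup>2 * ln (b\<^sup>2)) - M * b\<^sup>2 * (ln M + ln (b\<^sup>2)))"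
    proof -
      have "M * b\<^sup>2 * ln (b\<^sup>2) = s * x\<^sup>2 * b\<^sup>2 * ln (b\<^sup>2) + t * b\<^sup>2 * ln (b\<^sup>2)"
        by (simp add: M_def algebra_simps)
      then show ?thesis by (simp add: algebra_simps)
    qed
    finally show ?thesis unfolding 1(1) unfolding 1(2,3) 2 by simp
  qed
qed

text \<open>The reciprocal of the factor is the \<open>L\<close> of the two-point inequality, and
  this supplies its hypotheses. At \<open>s = t\<close> the continued value 1/2 gives
  \<open>L = 2\<close>. The bound \<open>2 \<le> L\<close> later also shows that the log-Sobolev
  constant is at most 1.\<close>

lemma two_point_factor_inverse:
  assumes s: "0 < s" "s \<le> t" "s + t = 1"
  shows "0 < two_point_factor s t" and "2 \<le> 1 / two_point_factor s t"
    and "1 / two_point_factor s t * (t - s) = ln t - ln s"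
proof -
  have "0 < two_point_factor s t \<and> 2 \<le> 1 / two_point_factor s t
      \<and> 1 / two_point_factor s t * (t - s) = ln t - ln s"
  proof (cases "s = t")
    case False
    then have st: "s < t" "0 < t" using s by simp_all
    have k: "two_point_factor s t = (t - s) / ln (t / s)"
      using False s(3) by (simp add: two_point_factor_def algebra_simps)
    have "2 * (t / s - 1) / (t / s + 1) \<le> ln (t / s)"
      using s st by (intro ln_ge_two_mult) simp
    also have "2 * (t / s - 1) / (t / s + 1) = 2 * (t - s) / (s + t)"
      using s(1) st by (simp add: divide_simps add_nonneg_eq_0_iff)
    finally have "2 * (t - s) \<le> ln (t / s)" using s(3) by simp
    moreover have "0 < ln (t / s)" using s(1) st by simp
    ultimately show ?thesis
      using st s(1) by (simp add: k pos_le_divide_eq ln_div)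
  qed (simp add: two_point_factor_def)
  then show "0 < two_point_factor s t" "2 \<le> 1 / two_point_factor s t"
    "1 / two_point_factor s t * (t - s) = ln t - ln s" by simp_all
qed

section \<open>From the two-point inequality to the exact constant\<close>

text \<open>Row sums and detailed balance leave a single free number, the flow between the two
  points. All Dirichlet forms are therefore multiples of the same square.\<close>

lemma dirichlet_form_two_point:
  fixes \<mu> :: "real^2" and Q :: "real^2^2"
  assumes "Q \<in> reversible_kernels \<mu>"
  shows "inner_wrt \<mu> ((mat 1 - Q) *v f) f = \<mu> $ 1 * Q $ 1 $ 2 * (f $ 1 - f $ 2)\<^sup>2"
proof -
  have diag: "Q $ 1 $ 1 = 1 - Q $ 1 $ 2" "Q $ 2 $ 2 = 1 - Q $ 2 $ 1"
    using reversible_kernel_rows(2)[OF assms, of 1] reversible_kernel_rows(2)[OF assms, of 2]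
    by (simp_all add: sum_2)
  have "inner_wrt \<mu> ((mat 1 - Q) *v f) f
      = \<mu> $ 1 * Q $ 1 $ 2 * (f $ 1 - f $ 2) * f $ 1 + \<mu> $ 2 * Q $ 2 $ 1 * (f $ 2 - f $ 1) * f $ 2"
    by (simp add: inner_wrt_def matrix_vector_mult_def sum_2 mat_def diag algebra_simps)
  also have "\<mu> $ 2 * Q $ 2 $ 1 = \<mu> $ 1 * Q $ 1 $ 2"
    using reversible_kernel_balance[OF assms] by simp
  finally show ?thesis by (simp add: algebra_simps power2_eq_square)
qed

lemma entropy_form_two_point:
  fixes \<mu> :: "real^2"
  assumes "\<And>i. 0 \<le> \<mu> $ i"
  defines "m \<equiv> \<lambda>f. \<mu> $ 1 * (f $ 1)\<^sup>2 + \<mu> $ 2 * (f $ 2)\<^sup>2"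
  shows "entropy_form \<mu> f = \<mu> $ 1 * ((f $ 1)\<^sup>2 * ln ((f $ 1)\<^sup>2)) + \<mu> $ 2 * ((f $ 2)\<^sup>2 * ln ((f $ 2)\<^sup>2))
           - m f * ln (m f)"
proof -
  have "inner_wrt \<mu> f f = m f"
    by (simp add: inner_wrt_def m_def sum_2 power2_eq_square mult_ac)
  then show ?thesis
    using assms(1) by (simp add: entropy_form_eq sum_2)
qed

text \<open>The two-point inequality bounds the entropy by \<open>s * t / k\<close> times a squared
  difference. The Dirichlet form is \<open>s * q\<close> times it, and the quotient of the two
  coefficients is the constant.\<close>

lemma log_sobolev_two_point:
  fixes \<mu> :: "real^2" and Q :: "real^2^2"
  assumes \<mu>: "prob_vector \<mu>" "0 < \<mu> $ 1" "\<mu> $ 1 \<le> \<mu> $ 2" and Q: "Q \<in> reversible_kernels \<mu>"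
  shows "log_sobolev \<mu> Q = Q $ 1 $ 2 / \<mu> $ 2 * two_point_factor (\<mu> $ 1) (\<mu> $ 2)"
proof -
  define s t q k where "s = \<mu> $ 1" "t = \<mu> $ 2" "q = Q $ 1 $ 2" "k = two_point_factor s t"
  note defs = this
  have s: "0 < s" "s \<le> t" "s + t = 1" and t: "0 < t" and q: "0 \<le> q"
    using \<mu> reversible_kernel_rows[OF Q] by (simp_all add: defs prob_vector_def sum_2)
  note k = two_point_factor_inverse[OF s, folded defs]
  let ?E = "\<lambda>f. s * q * (f $ 1 - f $ 2)\<^sup>2"
  let ?X = "{?E f / entropy_form \<mu> f | f. entropy_form \<mu> f \<noteq> 0}"
  have ls: "log_sobolev \<mu> Q = Inf ?X"
    by (simp add: log_sobolev_def dirichlet_form_two_point[OF Q] defs)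
  have ent: "entropy_form \<mu> f = s * ((f $ 1)\<^sup>2 * ln ((f $ 1)\<^sup>2)) + t * ((f $ 2)\<^sup>2 * ln ((f $ 2)\<^sup>2))
      - (s * (f $ 1)\<^sup>2 + t * (f $ 2)\<^sup>2) * ln (s * (f $ 1)\<^sup>2 + t * (f $ 2)\<^sup>2)" for f
    unfolding defs by (intro entropy_form_two_point prob_vector_nonneg \<mu>)
  have lower: "q / t * k \<le> ?E f / entropy_form \<mu> f" if "entropy_form \<mu> f \<noteq> 0" for f
  proof -
    have "entropy_form \<mu> f \<le> s * t * (1 / k) * (\<bar>f $ 1\<bar> - \<bar>f $ 2\<bar>)\<^sup>2"
      using two_point_entropy_le[OF s k(2,3), of "\<bar>f $ 1\<bar>" "\<bar>f $ 2\<bar>"] by (simp add: ent)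
    \<comment> \<open>Passing to absolute values left the entropy unchanged; by the reverse triangle
      inequality it does not increase the squared difference.\<close>
    also have "\<dots> \<le> s * t * (1 / k) * (f $ 1 - f $ 2)\<^sup>2"
      using s(1) t k(1) abs_triangle_ineq3[of "f $ 1" "f $ 2"]
      by (intro mult_left_mono) (auto simp: abs_le_square_iff)
    finally have "(q / t * k) * entropy_form \<mu> f \<le> (q / t * k) * (s * t * (1 / k) * (f $ 1 - f $ 2)\<^sup>2)"
      using q t k(1) by (intro mult_left_mono) auto
    also have "\<dots> = ?E f" using t k(1) by simp
    finally show ?thesis
      using that entropy_form_nonneg[OF \<mu>(1), of f] by (simp add: pos_le_divide_eq order_less_le)
  qed
  have attained: "Inf ?X = q / t * k"
  proof (cases "s = t")
    case False
    \<comment> \<open>The ratio of these values is \<open>t / s\<close>, the second zero of the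
      deficit.\<close>
    define f :: "real^2" where "f = (\<chi> i. if i = 1 then t else s)"
    have st: "s < t" using False s(2) by simp
    have "s * t\<^sup>2 + t * s\<^sup>2 = s * t * (s + t)"
      by (simp add: algebra_simps power2_eq_square)
    then have "s * t\<^sup>2 + t * s\<^sup>2 = s * t"
      using s(3) by simp
    then have "entropy_form \<mu> f = s * (t\<^sup>2 * (2 * ln t)) + t * (s\<^sup>2 * (2 * ln s)) - s * t * (ln s + ln t)"
      using s(1) t by (simp add: ent f_def ln_realpow ln_mult)
    also have "\<dots> = s * t * ((2 * t - 1) * ln t + (2 * s - 1) * ln s)"
      by (simp add: algebra_simps power2_eq_square)
    also have "2 * t - 1 = t - s" using s(3) by simp
    also have "2 * s - 1 = - (t - s)" using s(3) by simp
    also have "(t - s) * ln t + - (t - s) * ln s = (t - s) * (1 / k * (t - s))"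
      unfolding k(3) by (simp add: algebra_simps)
    finally have e: "entropy_form \<mu> f = s * t / k * (t - s)\<^sup>2"
      by (simp add: power2_eq_square)
    then have "entropy_form \<mu> f \<noteq> 0" using s(1) t st k(1) by simp
    moreover have "q / t * k = ?E f / entropy_form \<mu> f"
      unfolding e using s(1) t st k(1) by (simp add: f_def field_simps)
    ultimately show ?thesis
      using lower by (intro cInf_eq_minimum) blast+
  next
    case True
    then have half: "s = 1 / 2" "t = 1 / 2" "k = 1 / 2" using s(3) by (auto simp: defs(4) two_point_factor_def)
    \<comment> \<open>The extremal ratio is now 1, and a constant has zero entropy. These
      perturbations of a constant have variance \<open>e^2\<close>, hence nonzero entropy. As
      \<open>e\<close> tends to 0 both the entropy and the Dirichlet form over \<open>q\<close>
      behave like \<open>2 * e^2\<close>.\<close>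
    define f :: "real \<Rightarrow> real^2" where "f e = (\<chi> i. if i = 1 then 1 + e else 1 - e)" for e
    have pos: "entropy_form \<mu> (f e) \<noteq> 0" if "0 < e" "e < 1" for e
    proof -
      have "inner_wrt \<mu> (f e) (f e) - (\<Sum>x\<in>UNIV. \<mu> $ x * \<bar>f e $ x\<bar>)\<^sup>2 = e\<^sup>2"
      proof -
        have \<mu>12: "\<mu> $ 1 = 1 / 2" "\<mu> $ 2 = 1 / 2" using half by (simp_all add: defs)
        show ?thesis
          using that by (simp add: inner_wrt_def sum_2 f_def \<mu>12 power2_eq_square) (simp add: field_simps)
      qed
      then have "0 < e\<^sup>2 \<and> e\<^sup>2 \<le> entropy_form \<mu> (f e)"
        using variance_le_entropy_form[OF \<mu>(1), of "f e"] that by simp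
      then show ?thesis by linarith
    qed
    have "q / t * k = q" by (simp add: half)
    have lim: "((\<lambda>e. ?E (f e) / entropy_form \<mu> (f e)) \<longlongrightarrow> q / t * k) (at_right 0)"
    proof -
      have "1 / 2 * (1 + e)\<^sup>2 + 1 / 2 * (1 - e)\<^sup>2 = 1 + e\<^sup>2" for e :: real
        by (simp add: power2_eq_square field_simps)
      then have ent_f: "entropy_form \<mu> (f e) = (1 / 2) * ((1 + e)\<^sup>2 * ln ((1 + e)\<^sup>2))
          + (1 / 2) * ((1 - e)\<^sup>2 * ln ((1 - e)\<^sup>2)) - (1 + e\<^sup>2) * ln (1 + e\<^sup>2)" for e
        unfolding ent half by (simp add: f_def)
      have E_f: "?E (f e) = q * (2 * e\<^sup>2)" for e
        by (simp add: half f_def power2_eq_square)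
      have "((\<lambda>e::real. 2 * e\<^sup>2 / ((1 / 2) * ((1 + e)\<^sup>2 * ln ((1 + e)\<^sup>2)) + (1 / 2) * ((1 - e)\<^sup>2 * ln ((1 - e)\<^sup>2))
          - (1 + e\<^sup>2) * ln (1 + e\<^sup>2))) \<longlongrightarrow> 1) (at_right 0)"
        by real_asymp
      from tendsto_mult_left[OF this, of q] show ?thesis
        unfolding ent_f E_f by (simp add: half)
    qed
    have bdd: "bdd_below ?X"
      using lower by (intro bdd_belowI[of _ "q / t * k"]) blast
    have ev: "\<forall>\<^sub>F e in at_right 0. (0::real) < e \<and> e < 1"
      using eventually_at_right_less[of "0::real"] eventually_at_right_real[of 0 "1::real"]
      by (auto elim: eventually_mono)
    have "\<forall>\<^sub>F e in at_right 0. Inf ?X \<le> ?E (f e) / entropy_form \<mu> (f e)"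
      using ev
    proof eventually_elim
      case (elim e)
      then have "entropy_form \<mu> (f e) \<noteq> 0" using pos by blast
      then show ?case by (intro cInf_lower bdd) blast
    qed
    then have "Inf ?X \<le> q / t * k"
      by (rule tendsto_lowerbound[OF lim]) simp
    moreover have "q / t * k \<le> Inf ?X"
    proof (rule cInf_greatest)
      have "entropy_form \<mu> (f (1 / 2)) \<noteq> 0" by (rule pos) simp_all
      then show "?X \<noteq> {}" by blast
    qed (use lower in blast)
    ultimately show ?thesis by simp
  qed
  show ?thesis unfolding ls attained by (simp add: defs)
qed

section \<open>Iterates and lifted kernels\<close>

lemma reversible_kernels_mult_self:
  assumes "P \<in> reversible_kernels p"
  shows "P ** P \<in> reversible_kernels p"
proof -
  note rows = reversible_kernel_rows[OF assms]
  have "(\<Sum>y\<in>UNIV. (P ** P) $ x $ y) = 1" for x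
  proof -
    have "(\<Sum>y\<in>UNIV. (P ** P) $ x $ y) = (\<Sum>z\<in>UNIV. P $ x $ z * (\<Sum>y\<in>UNIV. P $ z $ y))"
      unfolding sum_distrib_left by (subst sum.swap) (simp add: matrix_matrix_mult_def)
    then show ?thesis by (simp add: rows)
  qed
  moreover have "0 \<le> (P ** P) $ x $ y" for x y
    by (simp add: matrix_matrix_mult_def rows(1) sum_nonneg)
  moreover have "p $ x * (P ** P) $ x $ y = p $ y * (P ** P) $ y $ x" for x y
  proof -
    have "p $ x * (P $ x $ z * P $ z $ y) = p $ y * (P $ y $ z * P $ z $ x)" for z
    proof -
      have "p $ x * (P $ x $ z * P $ z $ y) = p $ z * P $ z $ x * P $ z $ y"
        unfolding mult.assoc[symmetric] reversible_kernel_balance[OF assms, of x z] ..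
      also have "\<dots> = p $ z * P $ z $ y * P $ z $ x" by simp
      finally show ?thesis
        unfolding reversible_kernel_balance[OF assms, of z y] by simp
    qed
    then show ?thesis by (simp add: matrix_matrix_mult_def sum_distrib_left)
  qed
  ultimately show ?thesis
    by (simp add: reversible_kernels_def transition_matrix_def prob_vector_def)
qed

lemma matpow_nonneg:
  assumes "\<And>x y. 0 \<le> A $ x $ y"
  shows "0 \<le> matpow A l $ x $ y"
  using assms
  by (induction l arbitrary: x) (auto simp: mat_def matrix_matrix_mult_def intro!: sum_nonneg)

lemma matpow_stationary:
  assumes "P \<in> reversible_kernels p"
  shows "(\<Sum>x\<in>UNIV. p $ x * matpow P l $ x $ y) = p $ y"
proof (induction l)
  case 0
  then show ?case by (simp add: mat_def if_distrib cong: if_cong)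
next
  case (Suc l)
  then show ?case
    using reversible_kernel_stationary[OF assms, of "\<lambda>z. matpow P l $ z $ y"]
    by (simp add: matrix_matrix_mult_def)
qed

text \<open>For the identity kernel the divergence is the Shannon entropy of \<open>p\<close>, which
  is at most that of the uniform measure, by ln z <= z - 1.\<close>

lemma KL_div_mat_1_le:
  fixes p :: "real^'a::finite"
  assumes p: "prob_vector p" "\<And>x. 0 < p $ x"
  shows "KL_div p (mat 1) (const_rows p) \<le> ln CARD('a)"
proof -
  let ?n = "real CARD('a)"
  have n: "0 < ?n" by simp
  have "p $ x * ln (1 / p $ x) \<le> p $ x * ln ?n + (1 / ?n - p $ x)" for x
  proof -
    have "ln (1 / (?n * p $ x)) \<le> 1 / (?n * p $ x) - 1"
      using p(2)[of x] n by (intro ln_le_minus_one) simp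
    then have "p $ x * ln (1 / (?n * p $ x)) \<le> p $ x * (1 / (?n * p $ x) - 1)"
      using p(2)[of x] by (intro mult_left_mono) auto
    also have "p $ x * (1 / (?n * p $ x) - 1) = 1 / ?n - p $ x"
      using p(2)[of x] n by (simp add: field_simps)
    also have "ln (1 / (?n * p $ x)) = ln (1 / p $ x) - ln ?n"
      using p(2)[of x] n by (simp add: ln_div ln_mult)
    finally show ?thesis unfolding right_diff_distrib by linarith
  qed
  then have "(\<Sum>x\<in>UNIV. p $ x * ln (1 / p $ x)) \<le> (\<Sum>x\<in>UNIV. p $ x * ln ?n + (1 / ?n - p $ x))"
    by (intro sum_mono)
  also have "\<dots> = ln ?n"
    using sum_prob_vector[OF p(1)] n
    by (simp add: sum.distrib sum_subtractf flip: sum_distrib_right)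
  also have "(\<Sum>x\<in>UNIV. p $ x * ln (1 / p $ x)) = KL_div p (mat 1) (const_rows p)"
    by (simp add: KL_div_def mat_def const_rows_def if_distrib if_distribR cong: if_cong)
  finally show ?thesis .
qed

lemma KL_div_matpow_le:
  fixes p :: "real^'a::finite"
  assumes p: "prob_vector p" "\<And>x. 0 < p $ x" and P: "P \<in> reversible_kernels p"
    and le: "log_sobolev p (P ** P) \<le> 1"
  shows "KL_div p (matpow P l) (const_rows p) \<le> (1 - log_sobolev p (P ** P)) ^ l * ln CARD('a)"
proof (induction l)
  case 0
  then show ?case using KL_div_mat_1_le[OF p] by simp
next
  case (Suc l)
  have "KL_div p (matpow P (Suc l)) (const_rows p)
      \<le> (1 - log_sobolev p (P ** P)) * KL_div p (matpow P l) (const_rows p)"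
    unfolding matpow.simps
    by (intro KL_div_contraction p P matpow_nonneg matpow_stationary reversible_kernel_rows(1)[OF P])
  \<comment> \<open>The hypothesis \<open>le\<close> keeps the factor non-negative, so that it may
    multiply the induction hypothesis.\<close>
  also have "\<dots> \<le> (1 - log_sobolev p (P ** P)) * ((1 - log_sobolev p (P ** P)) ^ l * ln CARD('a))"
    using le by (intro mult_left_mono Suc.IH) simp
  finally show ?case by (simp add: mult.assoc)
qed

section \<open>Kernels lifted from the blocks of a partition\<close>

definition block_lift :: "real^'a::finite \<Rightarrow> ('a \<Rightarrow> 'k::finite) \<Rightarrow> real^'k^'k \<Rightarrow> real^'a^'a" where
  "block_lift p \<kappa> A = (\<chi> x y. A $ \<kappa> x $ \<kappa> y * (p $ y / mass p (\<kappa> -` {\<kappa> y})))"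

lemma sum_fibres:
  fixes \<kappa> :: "'a::finite \<Rightarrow> 'k::finite" and h :: "'a \<Rightarrow> real"
  shows "(\<Sum>x\<in>UNIV. h x) = (\<Sum>i\<in>UNIV. \<Sum>x\<in>\<kappa> -` {i}. h x)"
  using sum.group[of UNIV UNIV \<kappa> h] by (simp add: vimage_def)

lemma sum_fibre_measure:
  fixes p :: "real^'a::finite" and \<kappa> :: "'a \<Rightarrow> 'k::finite"
  shows "(\<Sum>x\<in>UNIV. p $ x * h (\<kappa> x)) = (\<Sum>i\<in>UNIV. mass p (\<kappa> -` {i}) * h i)"
  by (subst sum_fibres[of _ \<kappa>]) (simp add: mass_def sum_distrib_right)

lemma prob_vector_proj_measure:
  fixes p :: "real^'a::finite" and \<kappa> :: "'a \<Rightarrow> 'k::finite"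
  assumes "prob_vector p"
  shows "prob_vector (proj_measure p (\<lambda>i. \<kappa> -` {i}))"
  using sum_prob_vector[OF assms] prob_vector_nonneg[OF assms]
  by (simp add: prob_vector_def proj_measure_def mass_def sum_nonneg flip: sum_fibres)

text \<open>Encoding the blocks as fibres of a labelling makes them disjoint and covering, so the
  definite description in \<open>block_of\<close> resolves to the label
  \<open>\<kappa> x\<close>.\<close>

lemma gibbs_kernel_fibres:
  fixes p :: "real^'a::finite" and \<kappa> :: "'a \<Rightarrow> 'k::finite"
  shows "gibbs_kernel p (\<lambda>i. \<kappa> -` {i}) = (\<chi> x y. if \<kappa> x = \<kappa> y then p $ y / mass p (\<kappa> -` {\<kappa> x}) else 0)"
  by (auto simp: gibbs_kernel_def block_of_def vec_eq_iff)

text \<open>The left factor averages \<open>P\<close> over the starting block; the right one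
  redistributes the arriving mass inside the target block in proportion to \<open>p\<close>.\<close>

lemma gibbs_mult_gibbs:
  fixes p :: "real^'a::finite" and \<kappa> :: "'a \<Rightarrow> 'k::finite" and P :: "real^'a^'a"
  defines "G \<equiv> gibbs_kernel p (\<lambda>i. \<kappa> -` {i})"
  shows "G ** P ** G = block_lift p \<kappa> (proj_chain p (\<lambda>i. \<kappa> -` {i}) P)"
proof -
  have fib: "(\<Sum>x\<in>UNIV. if \<kappa> x = i then h x else 0) = (\<Sum>x\<in>\<kappa> -` {i}. h x)" for i and h :: "'a \<Rightarrow> real"
    by (simp add: sum.If_cases vimage_def)
  have "(G ** P ** G) $ x $ y = block_lift p \<kappa> (proj_chain p (\<lambda>i. \<kappa> -` {i}) P) $ x $ y" for x y
  proof -
    let ?m = "\<lambda>x. mass p (\<kappa> -` {\<kappa> x})"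
    have GP: "(G ** P) $ x $ w = (\<Sum>z\<in>\<kappa> -` {\<kappa> x}. p $ z * P $ z $ w) / ?m x" for w
    proof -
      have "(G ** P) $ x $ w = (\<Sum>z\<in>UNIV. if \<kappa> z = \<kappa> x then p $ z * P $ z $ w / ?m x else 0)"
        unfolding G_def gibbs_kernel_fibres matrix_matrix_mult_def
        by (auto intro!: sum.cong)
      then show ?thesis by (simp add: fib sum_divide_distrib)
    qed
    have "(G ** P ** G) $ x $ y = (\<Sum>w\<in>UNIV. if \<kappa> w = \<kappa> y then (G ** P) $ x $ w * (p $ y / ?m y) else 0)"
      unfolding G_def gibbs_kernel_fibres matrix_matrix_mult_def[of "_ ** _"]
      by (auto intro!: sum.cong)
    also have "\<dots> = (\<Sum>w\<in>\<kappa> -` {\<kappa> y}. \<Sum>z\<in>\<kappa> -` {\<kappa> x}. p $ z * P $ z $ w) / ?m x * (p $ y / ?m y)"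
      unfolding fib GP by (simp only: sum_distrib_right[symmetric] sum_divide_distrib[symmetric])
    finally show ?thesis
      by (subst (asm) sum.swap) (simp add: block_lift_def proj_chain_def)
  qed
  then show ?thesis by (simp add: vec_eq_iff)
qed

context
  fixes p :: "real^'a::finite" and \<kappa> :: "'a \<Rightarrow> 'k::finite"
  assumes p_pos: "\<And>x. 0 < p $ x" and surj: "surj \<kappa>"
begin

lemma mass_fibre_pos: "0 < mass p (\<kappa> -` {i})"
proof -
  obtain x where "\<kappa> x = i" using surj by (metis surjD)
  then show ?thesis
    unfolding mass_def using p_pos by (intro sum_pos) auto
qed

text \<open>The conditional measure of each block has total mass 1, so a sum over points collapses
  to one over labels. Both multiplicativity of lifting and invariance of the divergence rest on
  this.\<close>

lemma sum_fibre_conditional: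
  "(\<Sum>x\<in>UNIV. p $ x / mass p (\<kappa> -` {\<kappa> x}) * h (\<kappa> x)) = (\<Sum>i\<in>UNIV. h i)"
  using sum_fibre_measure[where p = p and \<kappa> = \<kappa> and h = "\<lambda>i. h i / mass p (\<kappa> -` {i})"] mass_fibre_pos
  by (simp add: less_imp_neq[symmetric])

lemma block_lift_mult: "block_lift p \<kappa> A ** block_lift p \<kappa> B = block_lift p \<kappa> (A ** B)"
proof -
  have "(block_lift p \<kappa> A ** block_lift p \<kappa> B) $ x $ y = block_lift p \<kappa> (A ** B) $ x $ y" for x y
    using sum_fibre_conditional[of "\<lambda>i. A $ \<kappa> x $ i * B $ i $ \<kappa> y * (p $ y / mass p (\<kappa> -` {\<kappa> y}))"]
    by (simp add: block_lift_def matrix_matrix_mult_def sum_distrib_left sum_distrib_right mult_ac sum_divide_distrib)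
  then show ?thesis by (simp add: vec_eq_iff)
qed

text \<open>The induction starts at 1 because the lift of the identity is the Gibbs kernel, not the
  identity.\<close>

lemma matpow_block_lift:
  assumes "1 \<le> l"
  shows "matpow (block_lift p \<kappa> A) l = block_lift p \<kappa> (matpow A l)"
  using assms
proof (induction l rule: dec_induct)
  case base
  then show ?case by simp
next
  case (step l)
  then show ?case by (simp add: block_lift_mult)
qed

text \<open>In the quotient by \<open>p $ y\<close> the weight inside the block cancels, so the
  logarithm depends on the two labels only.\<close>

lemma KL_div_block_lift:
  defines "\<mu> \<equiv> proj_measure p (\<lambda>i. \<kappa> -` {i})"
  shows "KL_div p (block_lift p \<kappa> A) (const_rows p) = KL_div \<mu> A (const_rows \<mu>)"
proof -
  define h where "h i j = A $ i $ j * ln (A $ i $ j / mass p (\<kappa> -` {j}))" for i j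
  have "KL_div p (block_lift p \<kappa> A) (const_rows p)
      = (\<Sum>x\<in>UNIV. p $ x * (\<Sum>y\<in>UNIV. p $ y / mass p (\<kappa> -` {\<kappa> y}) * h (\<kappa> x) (\<kappa> y)))"
    unfolding KL_div_def sum_distrib_left
  proof (intro sum.cong refl)
    fix x y
    show "p $ x * block_lift p \<kappa> A $ x $ y * ln (block_lift p \<kappa> A $ x $ y / const_rows p $ x $ y)
        = p $ x * (p $ y / mass p (\<kappa> -` {\<kappa> y}) * h (\<kappa> x) (\<kappa> y))"
      using p_pos[of y] by (simp add: block_lift_def const_rows_def h_def)
  qed
  also have "\<dots> = (\<Sum>i\<in>UNIV. mass p (\<kappa> -` {i}) * (\<Sum>j\<in>UNIV. h i j))"
    by (simp only: sum_fibre_conditional sum_fibre_measure[where p = p and \<kappa> = \<kappa> and h = "\<lambda>i. \<Sum>j\<in>UNIV. h i j"])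
  also have "\<dots> = KL_div \<mu> A (const_rows \<mu>)"
    by (simp add: KL_div_def \<mu>_def proj_measure_def const_rows_def h_def sum_distrib_left mult.assoc)
  finally show ?thesis .
qed

lemma proj_chain_reversible:
  assumes P: "P \<in> reversible_kernels p"
  shows "proj_chain p (\<lambda>i. \<kappa> -` {i}) P \<in> reversible_kernels (proj_measure p (\<lambda>i. \<kappa> -` {i}))"
proof -
  let ?Pb = "proj_chain p (\<lambda>i. \<kappa> -` {i}) P"
  have "(\<Sum>j\<in>UNIV. \<Sum>x\<in>\<kappa> -` {i}. \<Sum>y\<in>\<kappa> -` {j}. p $ x * P $ x $ y) = mass p (\<kappa> -` {i})" for i
  proof -
    have "(\<Sum>j\<in>UNIV. \<Sum>x\<in>\<kappa> -` {i}. \<Sum>y\<in>\<kappa> -` {j}. p $ x * P $ x $ y)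
        = (\<Sum>x\<in>\<kappa> -` {i}. \<Sum>y\<in>UNIV. p $ x * P $ x $ y)"
      by (subst sum.swap) (simp flip: sum_fibres)
    then show ?thesis
      using reversible_kernel_rows(2)[OF P] by (simp add: mass_def flip: sum_distrib_left)
  qed
  then have "(\<Sum>j\<in>UNIV. ?Pb $ i $ j) = 1" for i
    using mass_fibre_pos[of i] by (simp add: proj_chain_def flip: sum_divide_distrib)
  moreover have "0 \<le> ?Pb $ i $ j" for i j
    using mass_fibre_pos[of i] p_pos reversible_kernel_rows(1)[OF P]
    by (auto simp: proj_chain_def less_imp_le intro!: divide_nonneg_pos sum_nonneg)
  moreover have "mass p (\<kappa> -` {i}) * ?Pb $ i $ j = mass p (\<kappa> -` {j}) * ?Pb $ j $ i" for i j
  proof -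
    have "(\<Sum>x\<in>\<kappa> -` {i}. \<Sum>y\<in>\<kappa> -` {j}. p $ x * P $ x $ y) = (\<Sum>y\<in>\<kappa> -` {j}. \<Sum>x\<in>\<kappa> -` {i}. p $ y * P $ y $ x)"
      by (subst sum.swap) (simp only: reversible_kernel_balance[OF P])
    then show ?thesis
      using mass_fibre_pos[of i] mass_fibre_pos[of j] by (simp add: proj_chain_def)
  qed
  ultimately show ?thesis
    by (simp add: reversible_kernels_def transition_matrix_def prob_vector_def proj_measure_def)
qed

end

section \<open>The two-block partition\<close>

theorem corollary3p4:
  fixes p :: "real^'a::finite" and P :: "real^'a^'a" and S S' :: "'a set"
    and G :: "real^'a^'a" and Pb :: "real^2^2"
  assumes "prob_vector p" and "\<And>x. 0 < p $ x"
    and "P \<in> reversible_kernels p"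
    and "S \<union> S' = UNIV" and "S \<inter> S' = {}" and "S \<noteq> {}" and "S' \<noteq> {}"
    and "mass p S \<le> mass p S'"
    and "G = gibbs_kernel p (two_blocks S S')"
    and "Pb = proj_chain p (two_blocks S S') P"
  shows "log_sobolev (proj_measure p (two_blocks S S')) (Pb ** Pb)
           = (Pb ** Pb) $ 1 $ 2 / mass p S' * two_point_factor (mass p S) (mass p S')
       \<and> (\<forall>l::nat. 1 \<le> l \<longrightarrow>
            KL_div p (matpow (G ** P ** G) l) (const_rows p)
              \<le> (1 - (Pb ** Pb) $ 1 $ 2 / mass p S'
                       * two_point_factor (mass p S) (mass p S')) ^ l * ln 2)"
proof -
  define \<kappa> :: "'a \<Rightarrow> 2" where "\<kappa> x = (if x \<in> S then 1 else 2)" for x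
  have blocks: "two_blocks S S' = (\<lambda>i. \<kappa> -` {i})"
  proof
    fix i :: 2
    show "two_blocks S S' i = \<kappa> -` {i}"
      using assms(4,5) exhaust_2[of i] by (auto simp: two_blocks_def \<kappa>_def split: if_splits)
  qed
  have surj: "surj \<kappa>"
    unfolding surj_def
  proof
    fix i :: 2
    have "two_blocks S S' i \<noteq> {}" using assms(6,7) by (simp add: two_blocks_def)
    then show "\<exists>x. i = \<kappa> x" unfolding blocks by auto
  qed
  note block_facts = assms(2) surj
  define \<mu> where "\<mu> = proj_measure p (\<lambda>i. \<kappa> -` {i})"
  have \<mu>12: "\<mu> $ 1 = mass p S" "\<mu> $ 2 = mass p S'"
    unfolding \<mu>_def blocks[symmetric] by (simp_all add: proj_measure_def two_blocks_def)
  have \<mu>: "prob_vector \<mu>" "0 < \<mu> $ i" "\<mu> $ 1 \<le> \<mu> $ 2" for i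
    using prob_vector_proj_measure[OF assms(1), of \<kappa>] mass_fibre_pos[OF block_facts] assms(8)
    by (simp_all add: \<mu>_def[symmetric] \<mu>12) (simp add: \<mu>_def proj_measure_def)
  have Pb: "Pb \<in> reversible_kernels \<mu>"
    unfolding \<mu>_def assms(10) blocks by (rule proj_chain_reversible[OF block_facts assms(3)])
  have sq: "Pb ** Pb \<in> reversible_kernels \<mu>"
    by (rule reversible_kernels_mult_self[OF Pb])
  define \<alpha> where "\<alpha> = (Pb ** Pb) $ 1 $ 2 / mass p S' * two_point_factor (mass p S) (mass p S')"
  have ls: "log_sobolev \<mu> (Pb ** Pb) = \<alpha>"
    using log_sobolev_two_point[OF \<mu>(1,2,3) sq] by (simp add: \<alpha>_def \<mu>12)
  \<comment> \<open>Iterating the contraction requires a non-negative factor. It follows from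
    \<open>?k \<le> 1 / 2 \<le> \<mu> $ 2\<close> and from an entry of \<open>Pb ** Pb\<close> being
    at most 1.\<close>
  have "\<alpha> \<le> 1"
  proof -
    let ?k = "two_point_factor (\<mu> $ 1) (\<mu> $ 2)"
    have sum: "\<mu> $ 1 + \<mu> $ 2 = 1"
      using sum_prob_vector[OF \<mu>(1)] by (simp add: sum_2)
    have "0 < ?k" "?k \<le> 1 / 2"
      using two_point_factor_inverse[OF \<mu>(2,3) sum] by (simp_all add: field_simps)
    moreover have "(Pb ** Pb) $ 1 $ 2 \<le> 1"
      using reversible_kernel_rows[OF sq, of 1] by (simp add: sum_2) (metis add.commute le_add_same_cancel1)
    moreover have "1 / 2 \<le> \<mu> $ 2" using sum \<mu>(3) by simp
    ultimately have "(Pb ** Pb) $ 1 $ 2 * ?k \<le> \<mu> $ 2"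
      using mult_mono[of "(Pb ** Pb) $ 1 $ 2" 1 ?k "1 / 2"] by simp
    then show ?thesis
      using \<mu>(2)[of 2] unfolding \<alpha>_def \<mu>12 by simp
  qed
  have "KL_div p (matpow (G ** P ** G) l) (const_rows p) \<le> (1 - \<alpha>) ^ l * ln 2" if "1 \<le> l" for l
  proof -
    have "KL_div p (matpow (G ** P ** G) l) (const_rows p) = KL_div \<mu> (matpow Pb l) (const_rows \<mu>)"
      unfolding assms(9,10) blocks \<mu>_def gibbs_mult_gibbs
        matpow_block_lift[OF block_facts that] by (rule KL_div_block_lift[OF block_facts])
    \<comment> \<open>The constant \<open>ln 2\<close> is \<open>ln CARD(2)\<close>: the iteration
      runs on the two blocks, not on the original space.\<close>
    also have "\<dots> \<le> (1 - \<alpha>) ^ l * ln 2"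
      using KL_div_matpow_le[OF \<mu>(1,2) Pb, of l] ls \<open>\<alpha> \<le> 1\<close> by simp
    finally show ?thesis .
  qed
  then show ?thesis
    using ls by (simp add: \<alpha>_def \<mu>_def blocks)
qed

end
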